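(* Let $X$ be a nonsingular real algebraic variety. For any complex subvariety $V\subset\mathbb{C}X$ transverse to $\mathbb{R}X$, there exists a real algebraic subvariety $Y$ of $X$ such that $\mathbb{C}Y\subset V$ and $\mathbb{R}Y=V\cap\mathbb{R}X$.
   Context: A real algebraic variety $X$ consists of the set $\mathbb{C}X$ of its complex points (a complex algebraic variety), an anti-holomorphic involution $\mathrm{conj}:\mathbb{C}X\to\mathbb{C}X$ (the complex conjugation, which maps complex algebraic subvarieties to complex algebraic subvarieties), and the set $\mathbb{R}X=\mathrm{Fix}(\mathrm{conj})$ of real points. If $X$ is nonsingular, $\mathbb{C}X$ is a complex manifold and $\mathbb{R}X$ is a smooth submanifold of it. A real algebraic subvariety $Y$ of $X$ is given by a complex algebraic subvariety $\mathbb{C}Y\subset\mathbb{C}X$ invariant under $\mathrm{conj}$; its set of real points is $\mathbb{R}Y=\mathbb{C}Y\cap\mathbb{R}X$. A complex subvariety $V\subset\mathbb{C}X$ is transverse to $\mathbb{R}X$ if at every point $p\in V\cap\mathbb{R}X$ the variety $V$ is nonsingular and $T_pV+T_p\mathbb{R}X=T_p\mathbb{C}X$. *)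

theory Defs
  imports "HOL-Analysis.Analysis" "HOL-Library.Extended_Nat"
begin

text \<open>
  Complex algebraic varieties are taken in the sense of Serre: a set of points with a finite
  atlas of affine charts, regular changes of coordinates, and a closed diagonal. They are reduced
  and not necessarily irreducible. All charts take values in the same affine space
  \<open>complex ^ 'n\<close>; this is no restriction, as finitely many affine spaces embed into a common one.
\<close>

inductive_set polynomial_functions :: "(complex ^ 'n \<Rightarrow> complex) set" where
  const: "(\<lambda>x. c) \<in> polynomial_functions"
| coord: "(\<lambda>x. x $ k) \<in> polynomial_functions"
| add: "f \<in> polynomial_functions \<Longrightarrow> g \<in> polynomial_functions
    \<Longrightarrow> (\<lambda>x. f x + g x) \<in> polynomial_functions"
| mult: "f \<in> polynomial_functions \<Longrightarrow> g \<in> polynomial_functions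
    \<Longrightarrow> (\<lambda>x. f x * g x) \<in> polynomial_functions"

definition zariski_closed :: "(complex ^ 'n) set \<Rightarrow> bool" where
  "zariski_closed S \<longleftrightarrow> (\<exists>F \<subseteq> polynomial_functions. S = {x. \<forall>f\<in>F. f x = 0})"

definition regular_map :: "(complex ^ 'n) set \<Rightarrow> (complex ^ 'n \<Rightarrow> complex ^ 'm) \<Rightarrow> bool" where
  "regular_map S f \<longleftrightarrow>
     (\<forall>a\<in>S. \<exists>g h. (\<forall>k. g k \<in> polynomial_functions) \<and> h \<in> polynomial_functions \<and> h a \<noteq> 0 \<and>
        (\<forall>x\<in>S. h x \<noteq> 0 \<longrightarrow> (\<forall>k. f x $ k = g k x / h x)))"

definition join :: "complex ^ 'n \<Rightarrow> complex ^ 'm \<Rightarrow> complex ^ ('n + 'm)" where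
  "join x y = (\<chi> s. case s of Inl k \<Rightarrow> x $ k | Inr k \<Rightarrow> y $ k)"

type_synonym ('a, 'n) atlas = "('a set \<times> ('a \<Rightarrow> complex ^ 'n)) set"

definition points :: "('a, 'n::finite) atlas \<Rightarrow> 'a set" where
  "points A = (\<Union>(U, \<phi>)\<in>A. U)"

text \<open>
  For each pair of charts, the three conditions say that the overlap is Zariski open, that the
  change of coordinates is regular, and that the diagonal is closed (separatedness).
\<close>

definition complex_variety :: "('a, 'n::finite) atlas \<Rightarrow> bool" where
  "complex_variety A \<longleftrightarrow>
     finite A \<and>
     (\<forall>(U, \<phi>)\<in>A. inj_on \<phi> U \<and> zariski_closed (\<phi> ` U)) \<and>
     (\<forall>(U, \<phi>)\<in>A. \<forall>(W, \<psi>)\<in>A.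
        zariski_closed (\<phi> ` (U - W)) \<and>
        regular_map (\<phi> ` (U \<inter> W)) (\<psi> \<circ> inv_into U \<phi>) \<and>
        zariski_closed ((\<lambda>x. join (\<phi> x) (\<psi> x)) ` (U \<inter> W)))"

definition subvariety :: "('a, 'n::finite) atlas \<Rightarrow> 'a set \<Rightarrow> bool" where
  "subvariety A V \<longleftrightarrow>
     V \<subseteq> points A \<and> (\<forall>(U, \<phi>)\<in>A. zariski_closed (\<phi> ` (V \<inter> U)))"

definition irreducible_subvariety :: "('a, 'n::finite) atlas \<Rightarrow> 'a set \<Rightarrow> bool" where
  "irreducible_subvariety A Z \<longleftrightarrow>
     subvariety A Z \<and> Z \<noteq> {} \<and>
     (\<forall>Z1 Z2. subvariety A Z1 \<longrightarrow> subvariety A Z2 \<longrightarrow> Z = Z1 \<union> Z2 \<longrightarrow> Z = Z1 \<or> Z = Z2)"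

text \<open>
  The local dimension is the Krull dimension of the local ring of \<open>V\<close> at \<open>p\<close>: its prime ideals
  correspond to the irreducible subvarieties of \<open>V\<close> passing through \<open>p\<close>.
\<close>

definition local_dim :: "('a, 'n::finite) atlas \<Rightarrow> 'a set \<Rightarrow> 'a \<Rightarrow> enat" where
  "local_dim A V p =
     Sup {enat d | d. \<exists>Z. (\<forall>k\<le>d. irreducible_subvariety A (Z k) \<and> p \<in> Z k \<and> Z k \<subseteq> V) \<and>
                          (\<forall>k<d. Z k \<subset> Z (Suc k))}"

definition zariski_tangent :: "(complex ^ 'n) set \<Rightarrow> complex ^ 'n \<Rightarrow> (complex ^ 'n) set" where
  "zariski_tangent S a =
     {v. \<forall>f\<in>polynomial_functions. (\<forall>x\<in>S. f x = 0) \<longrightarrow> frechet_derivative f (at a) v = 0}"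

definition nonsingular_at :: "('a, 'n::finite) atlas \<Rightarrow> 'a set \<Rightarrow> 'a \<Rightarrow> bool" where
  "nonsingular_at A V p \<longleftrightarrow>
     (\<forall>(U, \<phi>)\<in>A. p \<in> U \<longrightarrow>
        enat (vec.dim (zariski_tangent (\<phi> ` (V \<inter> U)) (\<phi> p))) = local_dim A V p)"

definition nonsingular :: "('a, 'n::finite) atlas \<Rightarrow> bool" where
  "nonsingular A \<longleftrightarrow> (\<forall>p\<in>points A. nonsingular_at A (points A) p)"

text \<open>
  The tangent space of a smooth submanifold \<open>M\<close> of a Euclidean space, as the set of velocities of
  \<open>C\<^sup>1\<close> curves in \<open>M\<close>.
\<close>

definition curve_tangent :: "'v::real_normed_vector set \<Rightarrow> 'v \<Rightarrow> 'v set" where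
  "curve_tangent M a =
     {v. \<exists>\<gamma> e. e > 0 \<and> \<gamma> C1_differentiable_on {-e<..<e} \<and> \<gamma> ` {-e<..<e} \<subseteq> M \<and>
           \<gamma> 0 = a \<and> (\<gamma> has_vector_derivative v) (at 0)}"

definition antiholomorphic_on ::
    "(complex ^ 'n) set \<Rightarrow> (complex ^ 'n \<Rightarrow> complex ^ 'm) \<Rightarrow> bool" where
  "antiholomorphic_on N F \<longleftrightarrow>
     (\<forall>y\<in>N. \<exists>D. (F has_derivative D) (at y) \<and> (\<forall>z v. D (z *s v) = cnj z *s D v))"

text \<open>
  As the variety may be singular, a map is antiholomorphic if in charts it locally extends to an
  antiholomorphic map of the ambient affine spaces.
\<close>

definition antiholomorphic_map :: "('a, 'n::finite) atlas \<Rightarrow> ('a \<Rightarrow> 'a) \<Rightarrow> bool" where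
  "antiholomorphic_map A c \<longleftrightarrow>
     (\<forall>(U, \<phi>)\<in>A. \<forall>(W, \<psi>)\<in>A. \<forall>p\<in>U. c p \<in> W \<longrightarrow>
        (\<exists>N F. open N \<and> \<phi> p \<in> N \<and> antiholomorphic_on N F \<and>
           (\<forall>x\<in>U. \<phi> x \<in> N \<longrightarrow> c x \<in> W \<and> \<psi> (c x) = F (\<phi> x))))"

definition real_variety :: "('a, 'n::finite) atlas \<Rightarrow> ('a \<Rightarrow> 'a) \<Rightarrow> bool" where
  "real_variety A c \<longleftrightarrow>
     complex_variety A \<and>
     (\<forall>x\<in>points A. c x \<in> points A \<and> c (c x) = x) \<and>
     antiholomorphic_map A c \<and>
     (\<forall>V. subvariety A V \<longrightarrow> subvariety A (c ` V))"

definition real_points :: "('a, 'n::finite) atlas \<Rightarrow> ('a \<Rightarrow> 'a) \<Rightarrow> 'a set" where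
  "real_points A c = {x \<in> points A. c x = x}"

definition real_subvariety :: "('a, 'n::finite) atlas \<Rightarrow> ('a \<Rightarrow> 'a) \<Rightarrow> 'a set \<Rightarrow> bool" where
  "real_subvariety A c Y \<longleftrightarrow> subvariety A Y \<and> c ` Y = Y"

definition transverse_to_real_points :: "('a, 'n::finite) atlas \<Rightarrow> ('a \<Rightarrow> 'a) \<Rightarrow> 'a set \<Rightarrow> bool" where
  "transverse_to_real_points A c V \<longleftrightarrow>
     (\<forall>p \<in> V \<inter> real_points A c.
        nonsingular_at A V p \<and>
        (\<forall>(U, \<phi>)\<in>A. p \<in> U \<longrightarrow>
           {v + w | v w. v \<in> zariski_tangent (\<phi> ` (V \<inter> U)) (\<phi> p) \<and>
                         w \<in> curve_tangent (\<phi> ` (real_points A c \<inter> U)) (\<phi> p)}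
           = zariski_tangent (\<phi> ` U) (\<phi> p)))"

end

theory Submission imports Defs begin

text \<open>
  The subvariety is \<open>Y = V \<inter> conj V\<close>. It is a complex subvariety because the conjugation maps
  subvarieties to subvarieties and an intersection of two subvarieties is cut out by their equations
  taken together; it is invariant because the conjugation is an involution, which exchanges \<open>V\<close> and
  \<open>conj V\<close>. No real point of \<open>V\<close> is lost: a fixed point of the conjugation that lies in \<open>V\<close> lies
  in \<open>conj V\<close> as well.
\<close>

lemma zariski_closed_Int:
  assumes "zariski_closed S" and "zariski_closed T"
  shows "zariski_closed (S \<inter> T)"
proof -
  obtain F G where "F \<subseteq> polynomial_functions" "S = {x. \<forall>f\<in>F. f x = 0}"
    and "G \<subseteq> polynomial_functions" "T = {x. \<forall>f\<in>G. f x = 0}"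
    using assms unfolding zariski_closed_def by blast
  then have "F \<union> G \<subseteq> polynomial_functions" and "S \<inter> T = {x. \<forall>f\<in>F \<union> G. f x = 0}"
    by auto
  then show ?thesis
    unfolding zariski_closed_def by blast
qed

text \<open>
  Closedness is tested on images under charts, and these commute with intersections because charts
  are injective.
\<close>

lemma subvariety_Int:
  assumes A: "complex_variety A" and V: "subvariety A V" and W: "subvariety A W"
  shows "subvariety A (V \<inter> W)"
proof -
  have "zariski_closed (\<phi> ` (V \<inter> W \<inter> U))" if chart: "(U, \<phi>) \<in> A" for U \<phi>
  proof -
    have "inj_on \<phi> U"
      using A chart unfolding complex_variety_def by blast
    then have "\<phi> ` (V \<inter> W \<inter> U) = \<phi> ` (V \<inter> U) \<inter> \<phi> ` (W \<inter> U)"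
      by (auto simp: inj_on_def)
    moreover have "zariski_closed (\<phi> ` (V \<inter> U))" "zariski_closed (\<phi> ` (W \<inter> U))"
      using V W chart unfolding subvariety_def by blast+
    ultimately show ?thesis
      by (simp add: zariski_closed_Int)
  qed
  then show ?thesis
    using V unfolding subvariety_def by blast
qed

lemma real_subvariety_Int_conj:
  assumes X: "real_variety X c" and V: "subvariety X V"
  shows "real_subvariety X c (V \<inter> c ` V)"
proof -
  have "subvariety X (V \<inter> c ` V)"
    using X V subvariety_Int unfolding real_variety_def by blast
  moreover have involution: "c (c x) = x" if "x \<in> V" for x
    using X V that unfolding real_variety_def subvariety_def by blast
  have "c ` (V \<inter> c ` V) = V \<inter> c ` V"
  proof
    show "c ` (V \<inter> c ` V) \<subseteq> V \<inter> c ` V"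
      using involution by auto
    show "V \<inter> c ` V \<subseteq> c ` (V \<inter> c ` V)"
    proof
      fix x assume x: "x \<in> V \<inter> c ` V"
      then have "c x \<in> V \<inter> c ` V"
        using involution by auto
      moreover have "x = c (c x)"
        using x involution by simp
      ultimately show "x \<in> c ` (V \<inter> c ` V)"
        by blast
    qed
  qed
  ultimately show ?thesis
    unfolding real_subvariety_def by blast
qed

theorem mainTheorem3:
  fixes X :: "('a, 'n::finite) atlas" and c :: "'a \<Rightarrow> 'a" and V :: "'a set"
  assumes "real_variety X c"
    and "nonsingular X"
    and "subvariety X V"
    and "transverse_to_real_points X c V"
  shows "\<exists>Y. real_subvariety X c Y \<and> Y \<subseteq> V \<and>
           Y \<inter> real_points X c = V \<inter> real_points X c"
proof (intro exI conjI)
  show "real_subvariety X c (V \<inter> c ` V)"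
    using assms(1,3) by (rule real_subvariety_Int_conj)
  show "V \<inter> c ` V \<subseteq> V"
    by blast
  have "x \<in> c ` V" if "x \<in> V" "x \<in> real_points X c" for x
    using that unfolding real_points_def by (metis (mono_tags) imageI mem_Collect_eq)
  then show "V \<inter> c ` V \<inter> real_points X c = V \<inter> real_points X c"
    by blast
qed

end
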